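(* Fix any $n\times d$ permuted isotonic matrix $M\in\overline{\mathbb C}_{\mathrm{iso}}$ and any positive integer $p$. There exist $(\lambda,K_n,K_d)$, with $\lambda\in(0,1)$, $K_n\in[n]$, $K_d\in[d]$, and a matrix $M'\in\mathcal H(\lambda,K_n,K_d)$, such that $M\ge M'$ (entrywise) and $$8\,p\,\log_2(n\wedge d)\,\lambda^2K_nK_d+2^{-2p}\,nd\ \ge\ \|M\|_F^2 .$$
   Context: Notation: $n,d$ are positive integers; $[n]=\{1,\dots,n\}$; $n\wedge d=\min(n,d)$; $\log_2$ is the logarithm in base 2; $\|\cdot\|_F$ is the Frobenius norm; for matrices $A,B\in\mathbb R^{n\times d}$, $A\ge B$ means $A_{i,j}\ge B_{i,j}$ for all $(i,j)\in[n]\times[d]$. $\mathbb C_{\mathrm{iso}}$ is the set of matrices $A\in[0,1]^{n\times d}$ all of whose columns are non-increasing, i.e. $A_{i,k}\ge A_{i+1,k}$ for all $i\in[n-1]$, $k\in[d]$. For a permutation $\pi$ of $[n]$, $M_{\pi^{-1}}$ is the matrix with entries $(M_{\pi^{-1}})_{i,k}=M_{\pi^{-1}(i),k}$. $\overline{\mathbb C}_{\mathrm{iso}}$ (the class of permuted isotonic matrices) is the set of matrices $M$ for which there exists a permutation $\pi^*$ of $[n]$ with $M_{\pi^{*-1}}\in\mathbb C_{\mathrm{iso}}$. For $\lambda\in(0,1)$, $K_n\in[n]$ and $K_d\in[d]$, $\mathcal H(\lambda,K_n,K_d)$ is the set of $n\times d$ matrices of the form $\lambda\mathbf 1\{S\times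 T\}$ (entry $\lambda$ at positions in $S\times T$, zero elsewhere) with $S\subset[n]$, $|S|=K_n$, $T\subset[d]$, $|T|=K_d$.
   Formalization: Two cases where the claim fails are excluded: M = 0 (no M' with a positive entry lies below it), and n∧d = 1 (the logarithm vanishes; n = d = p = 1, M = (1) would need 1/4 ≥ 1). The formal statement assumes M ≠ 0 and n∧d ≥ 2. *)

theory Defs
  imports Complex_Main "HOL-Combinatorics.Permutations" "Jordan_Normal_Form.Matrix"
begin

(* Matrices are those of Jordan_Normal_Form, so row and column indices start at 0: the index sets
   {1,...,n} and {1,...,d} become {..<n} and {..<d}. The library order on matrices is entrywise. *)

definition C_iso :: "nat \<Rightarrow> nat \<Rightarrow> real mat set" where
  "C_iso n d = {A \<in> carrier_mat n d.
     (\<forall>i<n. \<forall>k<d. A $$ (i, k) \<in> {0..1}) \<and>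
     (\<forall>i k. i + 1 < n \<longrightarrow> k < d \<longrightarrow> A $$ (i, k) \<ge> A $$ (i + 1, k))}"

(* permute_rows f M has i-th row equal to row f i of M; thus M_{pi^{-1}} is permute_rows (inv_into UNIV pi) M
   (inv itself denotes the group inverse of HOL-Algebra here). *)
definition permute_rows :: "(nat \<Rightarrow> nat) \<Rightarrow> 'a mat \<Rightarrow> 'a mat" where
  "permute_rows f M = mat (dim_row M) (dim_col M) (\<lambda>(i, k). M $$ (f i, k))"

definition permuted_C_iso :: "nat \<Rightarrow> nat \<Rightarrow> real mat set" where
  "permuted_C_iso n d = {M \<in> carrier_mat n d.
     \<exists>\<pi>. \<pi> permutes {..<n} \<and> permute_rows (inv_into UNIV \<pi>) M \<in> C_iso n d}"

definition indicator_mat :: "nat \<Rightarrow> nat \<Rightarrow> (nat \<times> nat) set \<Rightarrow> real mat" where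
  "indicator_mat n d X = mat n d (\<lambda>(i, k). if (i, k) \<in> X then 1 else 0)"

definition H_class :: "nat \<Rightarrow> nat \<Rightarrow> real \<Rightarrow> nat \<Rightarrow> nat \<Rightarrow> real mat set" where
  "H_class n d l Kn Kd = {l \<cdot>\<^sub>m indicator_mat n d (S \<times> T) | S T.
     S \<subseteq> {..<n} \<and> card S = Kn \<and> T \<subseteq> {..<d} \<and> card T = Kd}"

definition frobenius_norm :: "real mat \<Rightarrow> real" where
  "frobenius_norm A = sqrt (\<Sum>i<dim_row A. \<Sum>k<dim_col A. (A $$ (i, k))\<^sup>2)"

end

theory Submission
  imports Defs
begin

text \<open>
  Two ideas carry the proof.

  First, a squared entry \<open>x\<^sup>2\<close> with \<open>0 \<le> x \<le> 1\<close> is, up to a factor \<open>4\<close> and an error \<open>2\<^bsup>-2p\<^esup>\<close>, bounded by the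
  sum of \<open>\<lambda>\<^sup>2\<close> over those dyadic thresholds \<open>\<lambda> = 1/2, 1/4, \<dots>, 2\<^bsup>-p\<^esup>\<close> that \<open>x\<close> reaches
  (\<open>power2_le_dyadic_layers\<close>). Summing over all entries, the squared Frobenius norm is at most
  \<open>4 \<Sum> \<lambda>\<^sup>2 |L(\<lambda>)| + 2\<^bsup>-2p\<^esup> n d\<close>, where \<open>L(\<lambda>)\<close> is the set of positions with entry at least \<open>\<lambda>\<close>. Hence one
  of the \<open>p\<close> thresholds satisfies \<open>\<parallel>M\<parallel>\<^sup>2 \<le> 4 p \<lambda>\<^sup>2 |L(\<lambda>)| + 2\<^bsup>-2p\<^esup> n d\<close>.

  Second, once the rows are permuted so that the columns decrease, \<open>L(\<lambda>)\<close> consists of an initial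
  segment in each column; up to the order of the columns it is a Young diagram. If every
  rectangle in a Young diagram has at most \<open>A\<close> cells, then its \<open>h\<close>-th longest row and its \<open>h\<close>-th
  longest column have at most \<open>A / h\<close> cells, so the diagram has at most
  \<open>A (1 + 1/2 + \<dots> + 1/m)\<close> cells, where \<open>m\<close> is the smaller number among rows and columns
  (\<open>staircase_has_large_rectangle\<close>). For \<open>m \<ge> 2\<close> the harmonic sum is at most \<open>2 log\<^sub>2 m\<close>. So \<open>L(\<lambda>)\<close> contains a
  rectangle \<open>S \<times> T\<close> with \<open>|L(\<lambda>)| \<le> 2 log\<^sub>2 m |S| |T|\<close>, and \<open>M' = \<lambda> 1{S \<times> T}\<close> is as required.
\<close>

section \<open>Rectangles in Young diagrams\<close>

text \<open>Each increment \<open>1 / (m + 1)\<close> is at most \<open>ln ((m + 1) / m)\<close>, since \<open>ln y \<le> y - 1\<close> at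
  \<open>y = m / (m + 1)\<close>, and passing from \<open>ln\<close> to the binary logarithm only increases the bound.\<close>

lemma harmonic_sum_le_log2:
  assumes "m \<ge> 1"
  shows "(\<Sum>i = 1..m. 1 / real i) \<le> 1 + log 2 (real m)"
  using assms
proof (induction m rule: dec_induct)
  case base
  show ?case by simp
next
  case (step m)
  have pos: "real m > 0" using step.hyps by simp
  have "ln (real m / (real m + 1)) \<le> real m / (real m + 1) - 1"
    using pos by (intro ln_le_minus_one) simp
  moreover have "real m / (real m + 1) - 1 = - (1 / (real m + 1))"
    using pos by (simp add: field_simps)
  moreover have "ln (real m / (real m + 1)) = ln (real m) - ln (real m + 1)"
    using pos by (simp add: ln_div)
  ultimately have "1 / (real m + 1) \<le> ln (real m + 1) - ln (real m)" by linarith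
  also have "\<dots> \<le> (ln (real m + 1) - ln (real m)) / ln 2"
  proof -
    have "0 \<le> ln (real m + 1) - ln (real m)" using pos by simp
    moreover have "0 < ln (2::real)" "ln (2::real) \<le> 1" using ln_le_minus_one[of "2::real"] by auto
    ultimately show ?thesis by (simp add: pos_le_divide_eq mult_left_le)
  qed
  also have "\<dots> = log 2 (real m + 1) - log 2 (real m)"
    by (simp add: log_def diff_divide_distrib)
  finally have "1 / (real m + 1) \<le> log 2 (real m + 1) - log 2 (real m)" .
  then show ?case using step.IH by (simp add: add.commute)
qed

text \<open>The \<open>h\<close>-th largest value of \<open>c\<close> is at most \<open>A / h\<close>. Sorting is avoided by an induction that
  removes an index where \<open>c\<close> is smallest: with \<open>m\<close> indices left, all \<open>m\<close> columns reach that
  height, so it is at most \<open>A / m\<close>.\<close>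

lemma sum_le_rectangle_times_harmonic_columns:
  fixes c :: "'a \<Rightarrow> nat" and A :: real
  assumes "finite T" and "\<And>h. real h * real (card {k \<in> T. h \<le> c k}) \<le> A"
  shows "real (\<Sum>k\<in>T. c k) \<le> A * (\<Sum>i = 1..card T. 1 / real i)"
  using assms
proof (induction "card T" arbitrary: T)
  case 0
  then show ?case by simp
next
  case (Suc m)
  then have "finite (c ` T)" and "c ` T \<noteq> {}" by auto
  then have "Min (c ` T) \<in> c ` T" by (rule Min_in)
  then obtain k0 where k0: "k0 \<in> T" "c k0 = Min (c ` T)" by force
  have k0_min: "c k0 \<le> c k" if "k \<in> T" for k
    using that k0 Suc.prems(1) by simp
  have m: "card (T - {k0}) = m" using Suc k0 by simp
  have "real h * real (card {k \<in> T - {k0}. h \<le> c k}) \<le> A" for h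
  proof -
    have "card {k \<in> T - {k0}. h \<le> c k} \<le> card {k \<in> T. h \<le> c k}"
      using Suc.prems(1) by (intro card_mono) auto
    then have "real h * real (card {k \<in> T - {k0}. h \<le> c k}) \<le> real h * real (card {k \<in> T. h \<le> c k})"
      by (intro mult_left_mono) auto
    then show ?thesis using Suc.prems(2)[of h] by linarith
  qed
  then have IH: "real (\<Sum>k\<in>T - {k0}. c k) \<le> A * (\<Sum>i = 1..m. 1 / real i)"
    using Suc.hyps(1)[of "T - {k0}"] Suc.prems(1) m by simp
  have "{k \<in> T. c k0 \<le> c k} = T" using k0_min by auto
  then have "real (c k0) * real (Suc m) \<le> A"
    using Suc.prems(2)[of "c k0"] Suc.hyps(2) by simp
  then have "real (c k0) \<le> A * (1 / real (Suc m))" by (simp add: pos_le_divide_eq)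
  moreover have "(\<Sum>k\<in>T. c k) = c k0 + (\<Sum>k\<in>T - {k0}. c k)"
    using k0 Suc.prems(1) by (simp add: sum.remove)
  ultimately show ?case using IH by (simp add: Suc.hyps(2)[symmetric] distrib_left)
qed

text \<open>The transposed count: the row at height \<open>h\<close> meets the columns with \<open>c k \<ge> h\<close>, hence has
  at most \<open>A / h\<close> cells.\<close>

lemma sum_le_rectangle_times_harmonic_rows:
  fixes c :: "'a \<Rightarrow> nat" and A :: real
  assumes "finite T" and c_le: "\<And>k. k \<in> T \<Longrightarrow> c k \<le> n"
    and rect: "\<And>h. real h * real (card {k \<in> T. h \<le> c k}) \<le> A"
  shows "real (\<Sum>k\<in>T. c k) \<le> A * (\<Sum>i = 1..n. 1 / real i)"
proof -
  have "c k = (\<Sum>h = 1..n. of_bool (h \<le> c k))" if "k \<in> T" for k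
  proof -
    have "{1..n} \<inter> {h. h \<le> c k} = {1..c k}" using c_le[OF that] by auto
    then show ?thesis by simp
  qed
  then have "(\<Sum>k\<in>T. c k) = (\<Sum>k\<in>T. \<Sum>h = 1..n. of_bool (h \<le> c k))" by (rule sum.cong[OF refl])
  also have "\<dots> = (\<Sum>h = 1..n. \<Sum>k\<in>T. of_bool (h \<le> c k))" by (rule sum.swap)
  also have "\<dots> = (\<Sum>h = 1..n. card {k \<in> T. h \<le> c k})"
    using assms(1) by (simp add: Int_def)
  finally have "real (\<Sum>k\<in>T. c k) = (\<Sum>h = 1..n. real (card {k \<in> T. h \<le> c k}))" by simp
  also have "\<dots> \<le> (\<Sum>h = 1..n. A * (1 / real h))"
    using rect by (intro sum_mono) (simp add: pos_le_divide_eq mult.commute)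
  finally show ?thesis by (simp add: sum_distrib_left)
qed

text \<open>The two harmonic bounds apply with \<open>A\<close> the area of a largest rectangle, and the shorter of
  the two harmonic sums is at most \<open>1 + log\<^sub>2 m \<le> 2 log\<^sub>2 m\<close> with \<open>m\<close> the smaller dimension.\<close>

lemma staircase_has_large_rectangle:
  fixes c :: "'a \<Rightarrow> nat"
  assumes "finite T" and c_le: "\<And>k. k \<in> T \<Longrightarrow> c k \<le> n" and m: "min n (card T) \<ge> 2"
  obtains h where "h \<in> {1..n}"
    and "real (\<Sum>k\<in>T. c k)
           \<le> 2 * log 2 (real (min n (card T))) * (real h * real (card {k \<in> T. h \<le> c k}))"
proof -
  define area where "area h = real h * real (card {k \<in> T. h \<le> c k})" for h
  have ne: "finite (area ` {1..n})" "area ` {1..n} \<noteq> {}" using m by auto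
  then have "Max (area ` {1..n}) \<in> area ` {1..n}" by (rule Max_in)
  then obtain h where h: "h \<in> {1..n}" "area h = Max (area ` {1..n})" by force
  have area_h: "area h \<ge> 0" by (simp add: area_def)
  have "area i \<le> area h" for i
  proof (cases "i \<in> {1..n}")
    case True
    then show ?thesis using h(2) ne by simp
  next
    case False
    then consider "i = 0" | "i > n" by fastforce
    then have "area i = 0"
    proof cases
      case 2
      then have no_column: "{k \<in> T. i \<le> c k} = {}" using c_le by fastforce
      show ?thesis unfolding area_def no_column by simp
    qed (simp add: area_def)
    then show ?thesis using area_h by simp
  qed
  then have rect: "real i * real (card {k \<in> T. i \<le> c k}) \<le> area h" for i
    by (simp add: area_def)
  have "real (\<Sum>k\<in>T. c k) \<le> area h * (\<Sum>i = 1..min n (card T). 1 / real i)"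
    using sum_le_rectangle_times_harmonic_columns[OF assms(1) rect]
      sum_le_rectangle_times_harmonic_rows[OF assms(1) c_le rect]
    by (simp add: min_def)
  also have "\<dots> \<le> area h * (2 * log 2 (real (min n (card T))))"
  proof (rule mult_left_mono[OF _ area_h])
    have "1 \<le> log 2 (real (min n (card T)))" using m by simp
    then show "(\<Sum>i = 1..min n (card T). 1 / real i) \<le> 2 * log 2 (real (min n (card T)))"
      using harmonic_sum_le_log2[of "min n (card T)"] m by linarith
  qed
  finally show thesis using h(1) by (intro that[of h]) (simp_all add: area_def mult.commute)
qed

section \<open>Dyadic level sets\<close>

text \<open>If \<open>x\<close> reaches the next threshold \<open>2\<^bsup>-(p+1)\<^esup>\<close>, its layer \<open>4 \<cdot> 4\<^bsup>-(p+1)\<^esup>\<close> replaces the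
  error term \<open>4\<^bsup>-p\<^esup>\<close> exactly; otherwise \<open>x\<^sup>2\<close> is below the new error term.\<close>

lemma power2_le_dyadic_layers:
  fixes x :: real
  assumes "0 \<le> x" "x \<le> 1"
  shows "x\<^sup>2 \<le> 4 * (\<Sum>q<p. ((1/2) ^ Suc q)\<^sup>2 * of_bool ((1/2) ^ Suc q \<le> x)) + ((1/2) ^ p)\<^sup>2"
proof (induction p)
  case 0
  show ?case using assms by (simp add: power_le_one)
next
  case (Suc p)
  show ?case
  proof (cases "(1/2) ^ Suc p \<le> x")
    case True
    have "4 * ((1/2::real) ^ Suc p)\<^sup>2 = ((1/2) ^ p)\<^sup>2" by (simp add: power_mult_distrib power_divide)
    then have "4 * (\<Sum>q<Suc p. ((1/2::real) ^ Suc q)\<^sup>2 * of_bool ((1/2) ^ Suc q \<le> x))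
        = 4 * (\<Sum>q<p. ((1/2) ^ Suc q)\<^sup>2 * of_bool ((1/2) ^ Suc q \<le> x)) + ((1/2) ^ p)\<^sup>2"
      using True by (simp add: distrib_left del: power_Suc)
    then show ?thesis using Suc zero_le_power2[of "(1/2::real) ^ Suc p"] by linarith
  next
    case False
    then have "x\<^sup>2 \<le> ((1/2) ^ Suc p)\<^sup>2" using assms by (intro power_mono) auto
    moreover have "0 \<le> (\<Sum>q<Suc p. ((1/2::real) ^ Suc q)\<^sup>2 * of_bool ((1/2) ^ Suc q \<le> x))"
      by (intro sum_nonneg mult_nonneg_nonneg) auto
    ultimately show ?thesis by linarith
  qed
qed

lemma downward_closed_less_card:
  fixes X :: "nat set"
  assumes "finite X" and "\<And>i j. j \<in> X \<Longrightarrow> i \<le> j \<Longrightarrow> i \<in> X" and "i < card X"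
  shows "i \<in> X"
proof (rule ccontr)
  assume "i \<notin> X"
  then have "X \<subseteq> {..<i}" using assms(2) by (meson lessThan_iff not_le subsetI)
  then have "card X \<le> i" using card_mono[of "{..<i}" X] by simp
  then show False using assms(3) by simp
qed

text \<open>Among the \<open>p\<close> dyadic thresholds, the one that maximises \<open>\<lambda>\<^sup>2 |L(\<lambda>)|\<close> carries at least the fraction
  \<open>1 / p\<close> of the sum over all layers. Since the columns decrease, \<open>L(\<lambda>)\<close> is determined by its column
  heights \<open>c\<close>, and the columns of height at least \<open>h\<close> all contain the first \<open>h\<close> rows.\<close>

lemma isotonic_sum_squares_le_rectangle:
  fixes a :: "nat \<Rightarrow> nat \<Rightarrow> real"
  assumes m: "min n d \<ge> 2" and p: "p \<ge> 1"
    and unit: "\<And>i k. i < n \<Longrightarrow> k < d \<Longrightarrow> 0 \<le> a i k \<and> a i k \<le> 1"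
    and antimono: "\<And>i j k. i \<le> j \<Longrightarrow> j < n \<Longrightarrow> k < d \<Longrightarrow> a j k \<le> a i k"
  obtains l h T where "l \<in> {0<..<1}" "h \<in> {1..n}" "T \<subseteq> {..<d}"
    "\<And>i k. i < h \<Longrightarrow> k \<in> T \<Longrightarrow> l \<le> a i k"
    "(\<Sum>i<n. \<Sum>k<d. (a i k)\<^sup>2) \<le> 8 * real p * log 2 (real (min n d)) * l\<^sup>2 * real h * real (card T)
       + ((1/2) ^ p)\<^sup>2 * real n * real d"
proof -
  define l :: "nat \<Rightarrow> real" where "l q = (1/2) ^ Suc q" for q
  define c where "c q k = card {i \<in> {..<n}. l q \<le> a i k}" for q k
  define mass where "mass q = (l q)\<^sup>2 * real (\<Sum>k<d. c q k)" for q
  have l01: "l q \<in> {0<..<1}" for q by (simp add: l_def power_Suc_less_one del: power_Suc)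
  have cells: "real (\<Sum>k<d. c q k) = (\<Sum>i<n. \<Sum>k<d. of_bool (l q \<le> a i k))" for q
  proof -
    have "real (\<Sum>k<d. c q k) = (\<Sum>k<d. \<Sum>i<n. of_bool (l q \<le> a i k))"
      by (simp add: c_def Int_def)
    also have "\<dots> = (\<Sum>i<n. \<Sum>k<d. of_bool (l q \<le> a i k))" by (rule sum.swap)
    finally show ?thesis .
  qed
  have "(\<Sum>i<n. \<Sum>k<d. (a i k)\<^sup>2)
      \<le> (\<Sum>i<n. \<Sum>k<d. 4 * (\<Sum>q<p. (l q)\<^sup>2 * of_bool (l q \<le> a i k)) + ((1/2) ^ p)\<^sup>2)"
    unfolding l_def by (intro sum_mono power2_le_dyadic_layers) (use unit in auto)
  also have "\<dots> = 4 * (\<Sum>i<n. \<Sum>k<d. \<Sum>q<p. (l q)\<^sup>2 * of_bool (l q \<le> a i k)) + ((1/2) ^ p)\<^sup>2 * real n * real d"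
    by (simp add: sum.distrib sum_distrib_left)
  also have "(\<Sum>i<n. \<Sum>k<d. \<Sum>q<p. (l q)\<^sup>2 * of_bool (l q \<le> a i k)) = (\<Sum>q<p. mass q)"
    unfolding mass_def cells sum_distrib_left
    by (simp only: sum.swap[of _ "{..<p}"])
  finally have layers: "(\<Sum>i<n. \<Sum>k<d. (a i k)\<^sup>2) \<le> 4 * (\<Sum>q<p. mass q) + ((1/2) ^ p)\<^sup>2 * real n * real d" .

  have ne: "finite (mass ` {..<p})" "mass ` {..<p} \<noteq> {}" using p by (auto simp: lessThan_empty_iff)
  then have "Max (mass ` {..<p}) \<in> mass ` {..<p}" by (rule Max_in)
  then obtain q where q: "mass q = Max (mass ` {..<p})" by force
  have "(\<Sum>r<p. mass r) \<le> (\<Sum>r<p. mass q)" using q ne by (intro sum_mono) simp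
  then have heaviest: "(\<Sum>r<p. mass r) \<le> real p * mass q" by simp

  have "c q k \<le> n" for k
    using card_mono[of "{..<n}" "{i \<in> {..<n}. l q \<le> a i k}"] by (auto simp: c_def)
  then obtain h where h: "h \<in> {1..n}" and big:
    "real (\<Sum>k<d. c q k) \<le> 2 * log 2 (real (min n d)) * (real h * real (card {k \<in> {..<d}. h \<le> c q k}))"
    using staircase_has_large_rectangle[of "{..<d}" "c q" n] m by auto
  define T where "T = {k \<in> {..<d}. h \<le> c q k}"
  have "l q \<le> a i k" if "i < h" "k \<in> T" for i k
  proof -
    have "i \<in> {i \<in> {..<n}. l q \<le> a i k}"
    proof (rule downward_closed_less_card)
      show "i < card {i \<in> {..<n}. l q \<le> a i k}" using that by (simp add: T_def c_def)
      show "i' \<in> {i \<in> {..<n}. l q \<le> a i k}" if "j \<in> {i \<in> {..<n}. l q \<le> a i k}" "i' \<le> j" for i' j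
        using that antimono[of i' j k] \<open>k \<in> T\<close> by (auto simp: T_def)
    qed simp
    then show ?thesis by simp
  qed
  moreover have "(\<Sum>i<n. \<Sum>k<d. (a i k)\<^sup>2)
      \<le> 8 * real p * log 2 (real (min n d)) * (l q)\<^sup>2 * real h * real (card T) + ((1/2) ^ p)\<^sup>2 * real n * real d"
  proof -
    have "real p * mass q
        \<le> real p * ((l q)\<^sup>2 * (2 * log 2 (real (min n d)) * (real h * real (card T))))"
      unfolding mass_def T_def by (intro mult_left_mono big) auto
    then have "4 * (\<Sum>r<p. mass r) \<le> 8 * real p * log 2 (real (min n d)) * (l q)\<^sup>2 * real h * real (card T)"
      using heaviest by (simp add: ac_simps)
    then show ?thesis using layers by linarith
  qed
  ultimately show thesis using that[OF l01 h, of T] by (auto simp: T_def)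
qed

section \<open>Permuted isotonic matrices\<close>

text \<open>Undoing the row permutation turns the rectangle in the first rows into one on an arbitrary
  set of rows. If no entry reaches any of the thresholds, the column set \<open>T\<close> of that rectangle is
  empty. In this case the inequality says that the error term alone bounds the norm, so any
  rectangle below \<open>M\<close> will do: a single positive entry of \<open>M\<close>, capped at \<open>1/2\<close> to stay inside the open
  interval, provides a \<open>1 \<times> 1\<close> rectangle.\<close>

theorem lemma2p1:
  fixes n d p :: nat and M :: "real mat"
  assumes "min n d \<ge> 2" and "p \<ge> 1"
    and "M \<in> permuted_C_iso n d" and "M \<noteq> 0\<^sub>m n d"
  shows "\<exists>(l::real) Kn Kd M'. l \<in> {0<..<1} \<and> Kn \<in> {1..n} \<and> Kd \<in> {1..d} \<and>
    M' \<in> H_class n d l Kn Kd \<and> M \<ge> M' \<and>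
    8 * real p * log 2 (real (min n d)) * l\<^sup>2 * real Kn * real Kd
      + 2 powi (- 2 * int p) * real n * real d \<ge> (frobenius_norm M)\<^sup>2"
proof -
  obtain \<pi> where \<pi>: "\<pi> permutes {..<n}" and iso: "permute_rows (inv_into UNIV \<pi>) M \<in> C_iso n d"
    and M: "M \<in> carrier_mat n d"
    using assms(3) by (auto simp: permuted_C_iso_def)
  define f where "f = inv_into UNIV \<pi>"
  have f: "f permutes {..<n}" unfolding f_def using \<pi> by (rule permutes_inv)
  define a where "a i k = M $$ (f i, k)" for i k
  have entry: "permute_rows f M $$ (i, k) = a i k" if "i < n" "k < d" for i k
    using that M by (simp add: permute_rows_def a_def)
  have unit: "0 \<le> a i k \<and> a i k \<le> 1" if "i < n" "k < d" for i k
    using iso that by (auto simp: C_iso_def f_def[symmetric] entry)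
  have a_Suc: "a (Suc i) k \<le> a i k" if "Suc i < n" "k < d" for i k
    using iso that by (auto simp: C_iso_def f_def[symmetric] entry)
  have antimono: "a j k \<le> a i k" if "i \<le> j" "j < n" "k < d" for i j k
    using that(1,2)
  proof (induction j rule: dec_induct)
    case (step j)
    then show ?case using a_Suc[of j k] \<open>k < d\<close> by simp
  qed simp
  have M_nonneg: "0 \<le> M $$ (i, k)" if "i < n" "k < d" for i k
  proof -
    obtain j where "j < n" "f j = i"
      using \<open>i < n\<close> permutes_image[OF f] by (metis imageE lessThan_iff)
    then show ?thesis using unit[of j k] \<open>k < d\<close> by (auto simp: a_def)
  qed
  have norm: "(frobenius_norm M)\<^sup>2 = (\<Sum>i<n. \<Sum>k<d. (a i k)\<^sup>2)"
  proof -
    have "(frobenius_norm M)\<^sup>2 = (\<Sum>i<n. \<Sum>k<d. (M $$ (i, k))\<^sup>2)"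
      using M by (simp add: frobenius_norm_def sum_nonneg)
    also have "\<dots> = (\<Sum>i<n. \<Sum>k<d. (M $$ (f i, k))\<^sup>2)"
      using sum.permute[OF f, of "\<lambda>i. \<Sum>k<d. (M $$ (i, k))\<^sup>2"] by (simp add: o_def)
    finally show ?thesis by (simp add: a_def)
  qed
  have error: "(2::real) powi (- 2 * int p) = ((1/2) ^ p)\<^sup>2"
  proof -
    have "(2::real) powi (- 2 * int p) = inverse (2 powi (int (2 * p)))"
      by (simp add: power_int_minus)
    also have "\<dots> = inverse (2 ^ (p * 2))" by (simp only: power_int_of_nat mult.commute)
    also have "\<dots> = ((1/2) ^ p)\<^sup>2" by (simp add: power_mult power_one_over inverse_eq_divide)
    finally show ?thesis .
  qed
  have below: "l \<cdot>\<^sub>m indicator_mat n d (S \<times> T) \<le> M"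
    if "\<And>i k. i \<in> S \<Longrightarrow> k \<in> T \<Longrightarrow> l \<le> M $$ (i, k)" for l S T
    using M that M_nonneg by (auto simp: less_eq_mat_def indicator_mat_def)

  obtain l h T where l: "l \<in> {0<..<1}" and h: "h \<in> {1..n}" and T: "T \<subseteq> {..<d}"
    and rect: "\<And>i k. i < h \<Longrightarrow> k \<in> T \<Longrightarrow> l \<le> a i k"
    and bound: "(\<Sum>i<n. \<Sum>k<d. (a i k)\<^sup>2)
       \<le> 8 * real p * log 2 (real (min n d)) * l\<^sup>2 * real h * real (card T) + ((1/2) ^ p)\<^sup>2 * real n * real d"
    using isotonic_sum_squares_le_rectangle[where a = a, OF assms(1,2) unit antimono] by blast
  show ?thesis
  proof (cases "T = {}")
    case False
    have finT: "finite T" using T by (rule finite_subset) simp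
    have "card T \<in> {1..d}"
      using False finT card_mono[OF _ T] by (simp add: Suc_le_eq card_gt_0_iff)
    moreover have "l \<cdot>\<^sub>m indicator_mat n d (f ` {..<h} \<times> T) \<in> H_class n d l h (card T)"
    proof -
      have "f ` {..<h} \<subseteq> {..<n}" using h permutes_image[OF f] by auto
      moreover have "card (f ` {..<h}) = h"
        using permutes_inj[OF f] by (simp add: card_image inj_on_subset)
      ultimately show ?thesis using T unfolding H_class_def by blast
    qed
    moreover have "l \<cdot>\<^sub>m indicator_mat n d (f ` {..<h} \<times> T) \<le> M"
      using rect by (intro below) (auto simp: a_def)
    ultimately show ?thesis using l h bound unfolding norm error by blast
  next
    case True
    have "\<exists>i<n. \<exists>k<d. M $$ (i, k) \<noteq> 0"
    proof (rule ccontr)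
      assume "\<not> ?thesis"
      then have "M = 0\<^sub>m n d" using M by (intro eq_matI) auto
      then show False using assms(4) by simp
    qed
    then obtain i k where ik: "i < n" "k < d" "0 < M $$ (i, k)"
      using M_nonneg by (metis less_eq_real_def)
    define e where "e = min (M $$ (i, k)) (1/2)"
    have "e \<in> {0<..<1}" using ik by (auto simp: e_def min_def)
    moreover have "e \<cdot>\<^sub>m indicator_mat n d ({i} \<times> {k}) \<in> H_class n d e 1 1"
      unfolding H_class_def using ik
      by (intro CollectI exI[of _ "{i}"] exI[of _ "{k}"]) simp
    moreover have "e \<cdot>\<^sub>m indicator_mat n d ({i} \<times> {k}) \<le> M"
      by (intro below) (auto simp: e_def)
    moreover have "(\<Sum>i<n. \<Sum>k<d. (a i k)\<^sup>2)
      \<le> 8 * real p * log 2 (real (min n d)) * e\<^sup>2 * real 1 * real 1 + ((1/2) ^ p)\<^sup>2 * real n * real d"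
    proof -
      have "0 \<le> log 2 (real (min n d))" using assms(1) by simp
      then have "0 \<le> 8 * real p * log 2 (real (min n d)) * e\<^sup>2 * real 1 * real 1" by simp
      moreover have "(\<Sum>i<n. \<Sum>k<d. (a i k)\<^sup>2) \<le> ((1/2) ^ p)\<^sup>2 * real n * real d"
        using bound True by simp
      ultimately show ?thesis by linarith
    qed
    moreover have "1 \<in> {1..n}" "1 \<in> {1..d}" using assms(1) by auto
    ultimately show ?thesis unfolding norm error by blast
  qed
qed

end
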